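(* Let $n\ge 0$, $k\in\mathbb{Z}$, $s\in\mathbb{Z}_{\ge0}$ and $a\in\mathbb{C}$ with $a\neq0$. Then \[ PC_{n}^{(k)}(x:a)=\sum_{m=0}^{n}\left\{(-1)^{m}\sum_{l=0}^{n-m}\sum_{i=0}^{l}\frac{\binom{n}{l}\binom{l}{i}}{a^{n-l+i}}S_{1}(n-l,m)\,\mathbb{C}_{i}^{(s)}\,PC_{l-i}^{(k)}(s:a)\right\}B_{m}^{(s)}(x). \]
   Context: For an integer $k$, $\mathrm{Lif}_k(t)=\sum_{n=0}^{\infty}\frac{t^{n}}{n!\,(n+1)^{k}}$. For $a\neq0$, $PC_n^{(k)}(x:a)$ is defined by $e^{-t}\,\mathrm{Lif}_k\!\left(\log\left(1+\frac{t}{a}\right)\right)\left(1+\frac{t}{a}\right)^{-x}=\sum_{n\ge0}PC_n^{(k)}(x:a)\frac{t^n}{n!}$. $S_1(n,l)$ denotes the (signed) Stirling numbers of the first kind, defined by $x(x-1)\cdots(x-n+1)=\sum_{l=0}^{n}S_1(n,l)x^l$. The Cauchy numbers of the first kind of order $s$ are defined by $\left(\frac{t}{\log(1+t)}\right)^{s}=\sum_{n\ge0}\mathbb{C}_n^{(s)}\frac{t^n}{n!}$. The Bernoulli polynomials of order $s$ are defined by $\left(\frac{t}{e^t-1}\right)^{s}e^{xt}=\sum_{n\ge0}B_n^{(s)}(x)\frac{t^n}{n!}$. *)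

theory Defs
  imports Complex_Main "HOL-Computational_Algebra.Computational_Algebra"
begin

text \<open>
  All generating functions are read as formal power series in \<open>t\<close> over the complex
  numbers. The library series \<open>fps_ln 1\<close> is \<open>log (1 + t)\<close>, \<open>fps_exp c\<close> is
  \<open>exp (c * t)\<close> and \<open>fps_binomial c\<close> is \<open>(1 + t)\<close> to the power \<open>c\<close>.
\<close>

definition Lif :: "int \<Rightarrow> complex fps" where
  "Lif k = Abs_fps (\<lambda>n. 1 / (fact n * of_nat (n + 1) powi k))"

definition PC_gf :: "int \<Rightarrow> complex \<Rightarrow> complex \<Rightarrow> complex fps" where
  "PC_gf k x a =
     (let u = fps_const (1 / a) * fps_X
      in fps_exp (- 1) * (Lif k oo (fps_ln 1 oo u)) * (fps_binomial (- x) oo u))"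

text \<open>\<open>PC n k x a\<close> is $PC_n^{(k)}(x:a)$.\<close>

definition PC :: "nat \<Rightarrow> int \<Rightarrow> complex \<Rightarrow> complex \<Rightarrow> complex" where
  "PC n k x a = fact n * fps_nth (PC_gf k x a) n"

definition S1 :: "nat \<Rightarrow> nat \<Rightarrow> int" where
  "S1 n l = coeff (\<Prod>i<n. [:- int i, 1:]) l"

lemma falling_factorial_eq_S1:
  fixes x :: "'a :: comm_ring_1"
  shows "(\<Prod>i<n. x - of_nat i) = (\<Sum>l\<le>n. of_int (S1 n l) * x ^ l)"
proof -
  let ?p = "\<Prod>i<n. [:- int i, 1:]"
  have deg: "degree ?p \<le> n"
    by (rule order_trans[OF degree_prod_sum_le]) simp_all
  have "poly (map_poly of_int ?p) x = (\<Sum>l\<le>n. of_int (S1 n l) * x ^ l)"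
  proof -
    have "degree (map_poly of_int ?p :: 'a poly) \<le> n"
      using deg by (intro degree_le) (auto simp: coeff_map_poly coeff_eq_0)
    then show ?thesis
      unfolding poly_altdef
      by (intro sum.mono_neutral_cong_left)
         (auto simp: S1_def coeff_map_poly intro!: le_degree)
  qed
  moreover have "poly (map_poly of_int ?p) x = (\<Prod>i<n. x - of_nat i)"
  proof (induction n)
    case (Suc n)
    have "map_poly of_int (p * [:- int n, 1:]) = map_poly of_int p * [:- of_nat n, 1 :: 'a:]" for p
      by (rule poly_eqI) (auto simp: coeff_map_poly coeff_mult of_int_sum coeff_pCons 
            split: nat.splits intro!: sum.cong)
    then have "poly (map_poly of_int (\<Prod>i<Suc n. [:- int i, 1:])) x =
        poly (map_poly of_int (\<Prod>i<n. [:- int i, 1:])) x * (x - of_nat n)"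
      by (simp only: prod.lessThan_Suc poly_mult) simp
    then show ?case by (simp only: Suc prod.lessThan_Suc)
  qed simp
  ultimately show ?thesis by simp
qed

text \<open>\<open>Cauchy1 s n\<close> is the \<open>n\<close>-th Cauchy number of the first kind of order \<open>s\<close>.
  Both series in the quotient below have zero constant term; power series division
  cancels the common factor \<open>t\<close>, likewise for the Bernoulli polynomials.\<close>

definition Cauchy1 :: "nat \<Rightarrow> nat \<Rightarrow> complex" where
  "Cauchy1 s n = fact n * fps_nth ((fps_X / fps_ln 1) ^ s) n"

definition Bernoulli_poly :: "nat \<Rightarrow> nat \<Rightarrow> complex \<Rightarrow> complex" where
  "Bernoulli_poly s n x = fact n * fps_nth ((fps_X / (fps_exp 1 - 1)) ^ s * fps_exp x) n"

end

theory Submission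
  imports Defs
begin

text \<open>
  Put \<open>u = t / a\<close> and \<open>L = log (1 + u)\<close>. Substituting \<open>t := - L\<close> into the generating function
  of the Bernoulli polynomials gives
  \<open>(L / (1 - e\<^sup>-\<^sup>L))\<^sup>s e\<^sup>-\<^sup>x\<^sup>L = (L (1 + u) / u)\<^sup>s (1 + u)\<^sup>-\<^sup>x\<close>.
  Multiplying by \<open>(u / L)\<^sup>s\<close>, the generating function of the Cauchy numbers, and by that of
  \<open>PC (s : a)\<close>, which carries the factor \<open>(1 + u)\<^sup>-\<^sup>s\<close>, leaves the generating function of
  \<open>PC (x : a)\<close>. Since \<open>L\<^sup>m / m!\<close> generates \<open>S1 _ m\<close>, the theorem is the comparison of
  coefficients in this product.
\<close>

text \<open>\<open>f\<close> has order exactly 1, so it divides \<open>fps_X\<close>: the quotients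
  defining the Cauchy and Bernoulli series are exact.\<close>

lemma fps_X_div_mult_cancel:
  fixes f :: "'a::field fps"
  assumes "f $ 0 = 0" "f $ 1 \<noteq> 0"
  shows "fps_X / f * f = fps_X"
proof -
  have "subdegree f = 1"
    using assms by (intro subdegreeI) auto
  moreover from this have "f \<noteq> 0" by auto
  ultimately have "f dvd fps_X"
    by (simp add: fps_dvd_iff)
  then show ?thesis by (rule dvd_div_mult_self)
qed

text \<open>The composite solves \<open>(1 + t) f' = c f\<close> with constant term 1, which
  characterises the binomial series.\<close>

lemma fps_exp_compose_ln:
  fixes c :: "'a::field_char_0"
  shows "fps_exp c oo fps_ln 1 = fps_binomial c"
proof -
  let ?f = "fps_exp c oo fps_ln 1"
  have "fps_deriv ?f = fps_const c * ?f * inverse (1 + fps_X)"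
    by (simp add: fps_compose_deriv fps_ln_deriv fps_const_mult_apply_left)
  also have "\<dots> = fps_const c * ?f / (1 + fps_X)"
    by (simp add: fps_divide_unit)
  finally show ?thesis
    by (intro iffD1[OF fps_binomial_ODE_unique']) simp
qed

lemma S1_eq_0: "n < m \<Longrightarrow> S1 n m = 0"
proof -
  assume "n < m"
  moreover have "degree (\<Prod>i<n. [:- int i, 1:]) \<le> n"
    by (rule order_trans[OF degree_prod_sum_le]) simp_all
  ultimately show ?thesis by (simp add: S1_def coeff_eq_0)
qed

text \<open>Both sides are coefficients of \<open>c\<^sup>m\<close> in \<open>n! [t\<^sup>n] (1 + t)\<^sup>c = n! [t\<^sup>n] e\<^sup>c\<^sup>L\<close>.\<close>

lemma fps_ln_power_nth:
  "(fps_ln 1 ^ m :: complex fps) $ n = fact m * of_int (S1 n m) / fact n"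
proof (cases "m \<le> n")
  case True
  define p :: "complex poly" where "p = (\<Sum>l\<le>n. monom (of_int (S1 n l) / fact n) l)"
  define q :: "complex poly" where "q = (\<Sum>l\<le>n. monom ((fps_ln 1 ^ l) $ n / fact l) l)"
  have "poly p c = poly q c" for c
  proof -
    have "poly p c = c gchoose n"
      by (simp add: p_def poly_sum poly_monom gbinomial_prod_rev atLeast0LessThan
            falling_factorial_eq_S1 sum_divide_distrib)
    also have "\<dots> = (fps_exp c oo fps_ln 1) $ n"
      by (simp add: fps_exp_compose_ln)
    also have "\<dots> = poly q c"
      by (simp add: fps_compose_nth q_def poly_sum poly_monom atLeast0AtMost mult.commute)
    finally show ?thesis .
  qed
  then have "p = q" by (simp add: poly_eq_poly_eq_iff[symmetric] fun_eq_iff)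
  then have "coeff p m = coeff q m" by simp
  with True show ?thesis
    by (simp add: p_def q_def coeff_sum if_distrib sum.delta' field_simps cong: if_cong)
next
  case False
  then show ?thesis
    by (simp add: S1_eq_0 startsby_zero_power_prefix)
qed

definition Bernoulli_gf :: "nat \<Rightarrow> complex \<Rightarrow> complex fps" where
  "Bernoulli_gf s x = (fps_X / (fps_exp 1 - 1)) ^ s * fps_exp x"

lemma fps_exp_compose_minus_ln:
  "fps_exp c oo (- fps_ln 1) = fps_binomial (- c :: complex)"
proof -
  have "fps_exp c oo (- fps_ln 1) = fps_exp c oo (- fps_X oo fps_ln 1)"
    by (simp add: fps_compose_uminus)
  also have "\<dots> = fps_exp (- c) oo fps_ln 1"
    by (subst fps_compose_assoc) simp_all
  finally show ?thesis by (simp add: fps_exp_compose_ln)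
qed

text \<open>Unscaled case \<open>u = t\<close>. Each of the \<open>s\<close> factors
  \<open>D(-L) * E\<close> equals \<open>1 + t\<close>, and \<open>(1 + t)\<close> to the power
  \<open>-s\<close> cancels them all.\<close>

lemma Bernoulli_gf_compose_minus_ln:
  "(Bernoulli_gf s x oo (- fps_ln 1)) * (fps_X / fps_ln 1) ^ s * fps_binomial (- of_nat s)
     = fps_binomial (- x)"
proof -
  let ?L = "fps_ln 1 :: complex fps"
  define D :: "complex fps" where "D = fps_X / (fps_exp 1 - 1)"
  define E where "E = fps_X / ?L"
  have E: "E * ?L = fps_X"
    unfolding E_def by (rule fps_X_div_mult_cancel) (simp_all add: fps_ln_nth)
  have inv: "fps_binomial (- 1) * (1 + fps_X) = (1 :: complex fps)"
    by (simp add: fps_binomial_minus_one inverse_mult_eq_1)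
  have "D * (fps_exp 1 - 1) = fps_X"
    unfolding D_def by (rule fps_X_div_mult_cancel) simp_all
  then have "(D oo - ?L) * (fps_exp 1 - 1 oo - ?L) = fps_X oo - ?L"
    by (simp flip: fps_compose_mult_distrib)
  then have "(D oo - ?L) * (fps_binomial (- 1) - 1) = - ?L"
    by (simp add: fps_compose_sub_distrib fps_exp_compose_minus_ln fps_X_fps_compose_startby0)
  \<comment> \<open>The factor \<open>1 + t\<close> turns \<open>1 / (1 + t) - 1\<close> into
    \<open>-t\<close>, and \<open>E\<close> turns \<open>L\<close> into \<open>t\<close>; then
    \<open>t\<close> cancels.\<close>
  then have "(D oo - ?L) * (fps_binomial (- 1) - 1) * (1 + fps_X) * E = - ?L * (1 + fps_X) * E"
    by simp
  moreover have "(D oo - ?L) * (fps_binomial (- 1) - 1) * (1 + fps_X) * E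
      = (D oo - ?L) * E * (fps_binomial (- 1) * (1 + fps_X) - (1 + fps_X))"
    by (simp add: algebra_simps)
  moreover have "- ?L * (1 + fps_X) * E = - ((E * ?L) * (1 + fps_X))"
    by (simp add: algebra_simps)
  ultimately have "fps_X * ((D oo - ?L) * E) = fps_X * (1 + fps_X)"
    unfolding inv E by (simp add: algebra_simps)
  then have DE: "(D oo - ?L) * E = 1 + fps_X"
    using mult_cancel_left fps_X_neq_zero by blast
  have "(Bernoulli_gf s x oo - ?L) * E ^ s * fps_binomial (- of_nat s)
      = ((D oo - ?L) * E) ^ s * fps_binomial (- of_nat s) * fps_binomial (- x)"
    by (simp add: Bernoulli_gf_def D_def[symmetric] fps_compose_mult_distrib
          fps_compose_power fps_exp_compose_minus_ln power_mult_distrib mult_ac)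
  also have "((D oo - ?L) * E) ^ s * fps_binomial (- of_nat s) = 1"
    unfolding DE by (simp flip: fps_binomial_of_nat fps_binomial_add_mult)
  finally show ?thesis by (simp add: E_def)
qed

text \<open>The \<open>m!\<close> in the Stirling formula for \<open>fps_ln 1 ^ m\<close> cancels
  the one in \<open>Bernoulli_poly\<close>; the sign comes from \<open>(-L)^m\<close>.\<close>

lemma Bernoulli_gf_compose_minus_ln_nth:
  "(Bernoulli_gf s x oo (- fps_ln 1)) $ n =
     (\<Sum>m=0..n. (- 1) ^ m * of_int (S1 n m) * Bernoulli_poly s m x) / fact n"
proof -
  have "((- fps_ln 1) ^ m :: complex fps) $ n = (- 1) ^ m * (fps_ln 1 ^ m) $ n" for m
    by (cases "even m") simp_all
  then show ?thesis
    by (simp add: fps_compose_nth fps_ln_power_nth Bernoulli_poly_def Bernoulli_gf_def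
          sum_divide_distrib mult_ac)
qed

text \<open>Rescaling by \<open>u\<close> splits the factor \<open>(1 + u)\<close> to the power
  \<open>-x\<close>; its part with exponent \<open>-s\<close> joins the exponential and
  \<open>Lif\<close> factors to form the middle series.\<close>

lemma PC_gf_expansion:
  fixes a :: complex
  defines "u \<equiv> fps_const (1 / a) * fps_X"
  shows "PC_gf k x a = ((fps_X / fps_ln 1) ^ s oo u) * PC_gf k (of_nat s) a *
           (Bernoulli_gf s x oo (- fps_ln 1) oo u)"
proof -
  have "u $ 0 = 0" by (simp add: u_def)
  then have "fps_binomial (- x) oo u = (Bernoulli_gf s x oo (- fps_ln 1) oo u) *
      ((fps_X / fps_ln 1) ^ s oo u) * (fps_binomial (- of_nat s) oo u)"
    by (simp flip: Bernoulli_gf_compose_minus_ln[of s x] fps_compose_mult_distrib)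
  then show ?thesis
    unfolding PC_gf_def u_def[symmetric] Let_def by (simp add: mult_ac)
qed

theorem theorem8:
  fixes n s :: nat and k :: int and a x :: complex
  assumes "a \<noteq> 0"
  shows "PC n k x a =
    (\<Sum>m=0..n.
      ((- 1) ^ m *
        (\<Sum>l=0..n - m. \<Sum>i=0..l.
          of_nat (n choose l) * of_nat (l choose i) / a ^ (n - l + i) *
          of_int (S1 (n - l) m) * Cauchy1 s i * PC (l - i) k (of_nat s) a)) *
      Bernoulli_poly s m x)"
proof -
  define g where "g l m = (- 1) ^ m * (\<Sum>i=0..l.
      of_nat (n choose l) * of_nat (l choose i) / a ^ (n - l + i) *
      of_int (S1 (n - l) m) * Cauchy1 s i * PC (l - i) k (of_nat s) a) *
    Bernoulli_poly s m x" for l m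
  \<comment> \<open>The two binomials multiply to \<open>n! / ((n - l)! i! (l - i)!)\<close>,
    absorbing all factorials.\<close>
  have summand: "fact n * ((1 / a) ^ i * ((fps_X / fps_ln 1) ^ s) $ i *
        PC_gf k (of_nat s) a $ (l - i) *
        ((1 / a) ^ (n - l) * ((- 1) ^ m * of_int (S1 (n - l) m) * Bernoulli_poly s m x / fact (n - l))))
      = (- 1) ^ m * (of_nat (n choose l) * of_nat (l choose i) / a ^ (n - l + i) *
          of_int (S1 (n - l) m) * Cauchy1 s i * PC (l - i) k (of_nat s) a) *
        Bernoulli_poly s m x"
    if "l \<le> n" "i \<le> l" for l i m
    using that unfolding power_add
    by (simp add: Cauchy1_def PC_def binomial_fact field_simps)
  have "PC n k x a = (\<Sum>l=0..n. \<Sum>m=0..n - l. g l m)"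
    unfolding PC_def PC_gf_expansion[of k x a s] fps_mult_nth[of _ _ n]
      sum_distrib_left
  proof (rule sum.cong[OF refl])
    fix l assume l: "l \<in> {0..n}"
    show "fact n * ((((fps_X / fps_ln 1) ^ s oo fps_const (1 / a) * fps_X) *
          PC_gf k (of_nat s) a) $ l *
        (Bernoulli_gf s x oo - fps_ln 1 oo fps_const (1 / a) * fps_X) $ (n - l))
      = (\<Sum>m=0..n - l. g l m)"
      unfolding fps_mult_nth fps_nth_compose_linear Bernoulli_gf_compose_minus_ln_nth g_def
        sum_divide_distrib sum_distrib_left sum_distrib_right
      by (rule sum.cong[OF refl], rule sum.cong[OF refl], rule summand) (use l in simp_all)
  qed
  \<comment> \<open>Writing the range as the triangle \<open>l + m \<le> n\<close> makes it
    symmetric, so the sums can be exchanged.\<close>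
  also have "\<dots> = (\<Sum>l\<in>{0..n}. \<Sum>m\<in>{m \<in> {0..n}. l + m \<le> n}. g l m)"
    by (intro sum.cong refl) auto
  also have "\<dots> = (\<Sum>m\<in>{0..n}. \<Sum>l\<in>{l \<in> {0..n}. l + m \<le> n}. g l m)"
    by (rule sum.swap_restrict) simp_all
  also have "\<dots> = (\<Sum>m=0..n. \<Sum>l=0..n - m. g l m)"
    by (intro sum.cong refl) auto
  finally show ?thesis
    by (simp add: g_def sum_distrib_left sum_distrib_right)
qed

end
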